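(* Let $p\ge 2$ and $t\ge1$ be integers and let $P_p$ be any ordered $2$-uniform path on $p$ vertices (a graph on $p$ vertices whose edges form a Hamiltonian path, with an arbitrary total order on its vertices). Then \[ R_{<,t}(P_p)\leq 2^{\frac{1}{\lceil\log_2 p\rceil}\left((\lceil\log_2 p\rceil+1)^{t-1}(\lceil\log_2 p\rceil^2-1)+1\right)}=2^{O\left(\log_2^t p\right)}. \]
   Context: An ordered graph is a graph with a totally ordered vertex set. An ordered graph $G$ is contained in an ordered graph $H$ if there is an injective order-preserving map $V(G)\to V(H)$ sending edges of $G$ to edges of $H$. $K_N$ is the complete graph on $[N]=\{1,\dots,N\}$ with the natural order. $R_{<,t}(G)$ is the least $N$ such that every coloring $c:E(K_N)\to[t]$ has a color class containing $G$. *)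

theory Defs
  imports Complex_Main "HOL-Library.Ramsey" "HOL-Library.Landau_Symbols"
begin

text \<open>An ordered graph is a pair of a vertex set and a set of two-element vertex sets (see
  \<open>ordered_graph\<close>); the total order of the vertices is that of the vertex type.\<close>

type_synonym 'a ograph = "'a set \<times> 'a set set"

abbreviation vertices :: "'a ograph \<Rightarrow> 'a set" where
  "vertices G \<equiv> fst G"

abbreviation edges :: "'a ograph \<Rightarrow> 'a set set" where
  "edges G \<equiv> snd G"

definition ordered_graph :: "'a::linorder ograph \<Rightarrow> bool" where
  "ordered_graph G \<longleftrightarrow> edges G \<subseteq> nsets (vertices G) 2"

definition contained_in :: "'a::linorder ograph \<Rightarrow> 'b::linorder ograph \<Rightarrow> bool" where
  "contained_in G H \<longleftrightarrow>
     (\<exists>f. f \<in> vertices G \<rightarrow> vertices H \<and> inj_on f (vertices G) \<and> mono_on (vertices G) f \<and>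
          (\<forall>e\<in>edges G. f ` e \<in> edges H))"

definition complete_graph :: "nat \<Rightarrow> nat ograph" where
  "complete_graph N = ({1..N}, nsets {1..N} 2)"

definition color_class :: "nat \<Rightarrow> (nat set \<Rightarrow> nat) \<Rightarrow> nat \<Rightarrow> nat ograph" where
  "color_class N c i = ({1..N}, {e \<in> edges (complete_graph N). c e = i})"

definition ordered_ramsey :: "nat \<Rightarrow> 'a::linorder ograph \<Rightarrow> nat" where
  "ordered_ramsey t G =
     (LEAST N. \<forall>c \<in> edges (complete_graph N) \<rightarrow> {1..t}. \<exists>i\<in>{1..t}. contained_in G (color_class N c i))"

text \<open>The list \<open>xs\<close> is the sequence of vertices along the path; it is
  unrelated to the order of the vertex type.\<close>

definition ordered_path :: "nat \<Rightarrow> 'a::linorder ograph \<Rightarrow> bool" where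
  "ordered_path p G \<longleftrightarrow> ordered_graph G \<and> card (vertices G) = p \<and>
     (\<exists>xs. distinct xs \<and> set xs = vertices G \<and>
           edges G = {{xs ! i, xs ! Suc i} | i. Suc i < length xs})"

definition path_exponent :: "nat \<Rightarrow> nat \<Rightarrow> real" where
  "path_exponent t p =
     (let l = real_of_int \<lceil>log 2 (real p)\<rceil>
      in 1 / l * ((l + 1) ^ (t - 1) * (l\<^sup>2 - 1) + 1))"

end

theory Submission imports Defs
begin

text \<open>Fix one colour, say red, and cut the vertex set into \<open>p\<close> intervals of equal size. Follow the
  path through the intervals prescribed by its vertex order, keeping the set of all red-reachable
  end points. If this set never drops below half of its interval, then a red copy of the path can be
  traced back; at the first drop, two sets of relative size \<open>1/(2p)\<close> with no red edge between them
  appear. Iterating inside both sets yields a red path or a set of \<open>2\<^sup>k\<close> vertices without red edges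
  as soon as there are \<open>(2p)\<^sup>k/2\<close> vertices. With \<open>p \<le> 2\<^sup>l\<close>, removing the colours one by one leads
  to the recursion \<open>e(t+1) = (l+1) e(t) - 1\<close>, \<open>e(0) = 1\<close>, for the exponent of \<open>2\<close>.\<close>

section \<open>Ordered blocks and containment\<close>

text \<open>List \<open>V\<close> increasingly and give the element of rank \<open>r\<close> in
  \<open>U\<close> the \<open>s\<close> consecutive positions starting at \<open>r * s\<close>;
  surplus elements of \<open>V\<close> are left over.\<close>

lemma ex_ordered_blocks:
  fixes U :: "'a::linorder set" and V :: "'b::linorder set"
  assumes "finite U" "finite V" "card U * s \<le> card V"
  obtains J where "\<And>x. x \<in> U \<Longrightarrow> J x \<subseteq> V" "\<And>x. x \<in> U \<Longrightarrow> card (J x) = s"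
    "\<And>x y a b. \<lbrakk>x \<in> U; y \<in> U; x < y; a \<in> J x; b \<in> J y\<rbrakk> \<Longrightarrow> a < b"
proof -
  define r where "r x = card {y \<in> U. y < x}" for x
  define vs where "vs = sorted_list_of_set V"
  define J where "J x = (\<lambda>k. vs ! (r x * s + k)) ` {..<s}" for x
  have len: "length vs = card V" and set: "set vs = V"
    and sorted: "sorted_wrt (<) vs" and dist: "distinct vs"
    using assms(2) by (auto simp: vs_def)
  have r_mono: "r x < r y" if "x \<in> U" "x < y" for x y
    unfolding r_def using that assms(1) by (intro psubset_card_mono) auto
  have r_less: "r x < card U" if "x \<in> U" for x
    unfolding r_def using that assms(1) by (intro psubset_card_mono) auto
  have step: "i * s + k < j * s" if "i < j" "k < s" for i j k
  proof -
    have "i * s + k < Suc i * s" using that by simp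
    also have "\<dots> \<le> j * s" using that by (intro mult_le_mono1) auto
    finally show ?thesis .
  qed
  have bound: "r x * s + k < length vs" if "x \<in> U" "k < s" for x k
    using step[OF r_less[OF that(1)] that(2)] assms(3) len by linarith
  show thesis
  proof
    show "J x \<subseteq> V" if "x \<in> U" for x
      using bound[OF that] set by (auto simp: J_def)
    show "card (J x) = s" if "x \<in> U" for x
    proof -
      have "inj_on (\<lambda>k. vs ! (r x * s + k)) {..<s}"
        using bound[OF that] dist by (auto simp: inj_on_def nth_eq_iff_index_eq)
      then show ?thesis by (simp add: J_def card_image)
    qed
    show "a < b" if xy: "x \<in> U" "y \<in> U" "x < y" and a: "a \<in> J x" and b: "b \<in> J y" for x y a b
    proof -
      obtain i j where "i < s" "j < s" "a = vs ! (r x * s + i)" "b = vs ! (r y * s + j)"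
        using a b by (auto simp: J_def)
      moreover have "r x * s + i < r y * s + j"
        using step[OF r_mono[OF xy(1,3)] \<open>i < s\<close>] by linarith
      ultimately show ?thesis
        using sorted_wrt_nth_less[OF sorted] bound[OF xy(2)] by simp
    qed
  qed
qed

lemma contained_in_mono:
  assumes "contained_in G (V, E)" "V \<subseteq> V'" "E \<subseteq> E'"
  shows "contained_in G (V', E')"
proof -
  obtain f where "f \<in> vertices G \<rightarrow> V" "inj_on f (vertices G)" "mono_on (vertices G) f"
    "\<forall>e\<in>edges G. f ` e \<in> E"
    using assms(1) by (auto simp: contained_in_def)
  then show ?thesis
    unfolding contained_in_def using assms(2,3) by (intro exI[of _ f]) auto
qed

lemma contained_inI_strict_mono:
  assumes "f \<in> vertices G \<rightarrow> vertices H" "\<And>e. e \<in> edges G \<Longrightarrow> f ` e \<in> edges H"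
    and less: "\<And>x y. \<lbrakk>x \<in> vertices G; y \<in> vertices G; x < y\<rbrakk> \<Longrightarrow> f x < f y"
  shows "contained_in G H"
proof -
  have sm: "strict_mono_on (vertices G) f"
    using less by (auto simp: strict_mono_on_def)
  show ?thesis
    unfolding contained_in_def
    using assms(1,2) strict_mono_on_imp_inj_on[OF sm] strict_mono_on_imp_mono_on[OF sm] by blast
qed

text \<open>Blocks of size 1 already give an order embedding. The later use is contrapositive: a
  large enough set whose edges do not contain \<open>G\<close> must miss some pair.\<close>

lemma contained_in_complete:
  fixes V :: "'b::linorder set"
  assumes G: "ordered_graph G" and "finite (vertices G)" "finite V" "card (vertices G) \<le> card V"
  shows "contained_in G (V, nsets V 2)"
proof -
  have le: "card (vertices G) * 1 \<le> card V" using assms by simp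
  obtain J where J: "\<And>x. x \<in> vertices G \<Longrightarrow> J x \<subseteq> V" "\<And>x. x \<in> vertices G \<Longrightarrow> card (J x) = 1"
    "\<And>x y a b. \<lbrakk>x \<in> vertices G; y \<in> vertices G; x < y; a \<in> J x; b \<in> J y\<rbrakk> \<Longrightarrow> a < b"
    using ex_ordered_blocks[OF \<open>finite (vertices G)\<close> \<open>finite V\<close> le] by blast
  define f where "f x = (SOME a. a \<in> J x)" for x
  have f: "f x \<in> J x" if "x \<in> vertices G" for x
    unfolding f_def some_in_eq using J(2)[OF that] by auto
  have less: "f x < f y" if "x \<in> vertices G" "y \<in> vertices G" "x < y" for x y
    using J(3)[OF that] f that by blast
  have inj: "inj_on f (vertices G)"
    by (metis inj_onI less linorder_neqE order_less_irrefl)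
  show ?thesis
  proof (rule contained_inI_strict_mono)
    show "f \<in> vertices G \<rightarrow> vertices (V, nsets V 2)" using f J(1) by auto
    show "f ` e \<in> edges (V, nsets V 2)" if "e \<in> edges G" for e
    proof -
      have "e \<subseteq> vertices G" "finite e" "card e = 2"
        using that G by (auto simp: ordered_graph_def nsets_def)
      then show ?thesis using f J(1) inj
        by (auto simp: nsets_def card_image inj_on_subset)
    qed
  qed (fact less)
qed

section \<open>One colour: a path or a large set without edges\<close>

text \<open>Block size \<open>2 * m\<close> serves both sets: where the reachable set first falls
  below \<open>m\<close>, its predecessor still has \<open>m\<close> elements, and more than
  \<open>m\<close> elements of the current block are not reached.\<close>

lemma path_or_sparse_pair:
  fixes P :: "'a::linorder ograph" and V :: "'b::linorder set" and E :: "'b set set"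
  assumes P: "ordered_path p P" and "p > 0" "finite V" and V: "p * (2 * m) \<le> card V"
    and nc: "\<not> contained_in P (V, E)"
  obtains A B where "A \<subseteq> V" "B \<subseteq> V" "A \<inter> B = {}" "m \<le> card A" "m \<le> card B"
    "\<And>a b. \<lbrakk>a \<in> A; b \<in> B\<rbrakk> \<Longrightarrow> {a, b} \<notin> E"
proof (cases "m = 0")
  \<comment> \<open>Here having at least \<open>m\<close> elements would not make the last reachable
    set nonempty, so this case is split off.\<close>
  case True
  then show ?thesis using that[of "{}" "{}"] by simp
next
  case False
  obtain xs where xs: "distinct xs" "set xs = vertices P"
    "edges P = {{xs ! i, xs ! Suc i} | i. Suc i < length xs}" and card: "card (vertices P) = p"
    using P by (auto simp: ordered_path_def)
  have len: "length xs = p" using xs card distinct_card by metis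
  have fin: "finite (vertices P)" using xs(2) by (metis List.finite_set)
  have le: "card (vertices P) * (2 * m) \<le> card V" using V card by simp
  obtain J where J: "\<And>x. x \<in> vertices P \<Longrightarrow> J x \<subseteq> V" "\<And>x. x \<in> vertices P \<Longrightarrow> card (J x) = 2 * m"
    "\<And>x y a b. \<lbrakk>x \<in> vertices P; y \<in> vertices P; x < y; a \<in> J x; b \<in> J y\<rbrakk> \<Longrightarrow> a < b"
    using ex_ordered_blocks[OF fin \<open>finite V\<close> le] by blast
  have mem: "xs ! i \<in> vertices P" if "i < p" for i
    using that xs(2) len nth_mem by metis
  \<comment> \<open>\<open>S i\<close> collects the end points of walks in \<open>E\<close> through
    the blocks of \<open>xs ! 0\<close>, ..., \<open>xs ! i\<close> in turn.\<close>
  define S where "S = rec_nat (J (xs ! 0)) (\<lambda>i A. {b \<in> J (xs ! Suc i). \<exists>a\<in>A. {a, b} \<in> E})"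
  have S_0: "S 0 = J (xs ! 0)"
    and S_Suc: "S (Suc i) = {b \<in> J (xs ! Suc i). \<exists>a\<in>S i. {a, b} \<in> E}" for i
    by (simp_all add: S_def)
  have S_sub: "S i \<subseteq> J (xs ! i)" for i
    by (cases i) (auto simp: S_0 S_Suc)
  have trace: "\<exists>f. f (xs ! n) = b \<and> (\<forall>i\<le>n. f (xs ! i) \<in> J (xs ! i)) \<and>
      (\<forall>i<n. {f (xs ! i), f (xs ! Suc i)} \<in> E)" if "n < p" "b \<in> S n" for n b
    using that
  proof (induction n arbitrary: b)
    case 0
    then show ?case by (intro exI[of _ "\<lambda>_. b"]) (simp add: S_0)
  next
    case (Suc n)
    obtain a where a: "a \<in> S n" "{a, b} \<in> E" and b: "b \<in> J (xs ! Suc n)"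
      using Suc.prems(2) by (auto simp: S_Suc)
    obtain f where f: "f (xs ! n) = a" "\<forall>i\<le>n. f (xs ! i) \<in> J (xs ! i)"
      "\<forall>i<n. {f (xs ! i), f (xs ! Suc i)} \<in> E"
      using Suc.IH[OF _ a(1)] Suc.prems(1) by auto
    \<comment> \<open>Distinctness of \<open>xs\<close> keeps the values of \<open>f\<close> at
      earlier path vertices intact under the update at \<open>xs ! Suc n\<close>.\<close>
    have ne: "xs ! i \<noteq> xs ! Suc n" if "i \<le> n" for i
      using that Suc.prems(1) xs(1) len by (simp add: nth_eq_iff_index_eq)
    show ?case
      using f a(2) b ne
      by (intro exI[of _ "f(xs ! Suc n := b)"]) (auto simp: le_Suc_eq less_Suc_eq)
  qed
  \<comment> \<open>Otherwise an end point exists in the last block and can be traced back. One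
    element per block respects the vertex order, however the path jumps between blocks.\<close>
  have "\<exists>i<p. card (S i) < m"
  proof (rule ccontr)
    assume "\<not> ?thesis"
    then have "card (S (p - 1)) > 0" using \<open>p > 0\<close> False by (metis diff_less gr0I less_one linorder_not_less le_zero_eq)
    then obtain b where "b \<in> S (p - 1)" by (metis card_gt_0_iff ex_in_conv)
    then obtain f where f: "\<forall>i\<le>p-1. f (xs ! i) \<in> J (xs ! i)"
      "\<forall>i<p-1. {f (xs ! i), f (xs ! Suc i)} \<in> E"
      using trace[of "p - 1" b] \<open>p > 0\<close> by auto
    have fJ: "f x \<in> J x" if "x \<in> vertices P" for x
    proof -
      obtain i where "i < p" "x = xs ! i" using \<open>x \<in> vertices P\<close> xs(2) len in_set_conv_nth by metis
      then show ?thesis using f(1) by simp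
    qed
    have "contained_in P (V, E)"
    proof (rule contained_inI_strict_mono)
      show "f \<in> vertices P \<rightarrow> vertices (V, E)" using fJ J(1) by auto
      show "f ` e \<in> edges (V, E)" if "e \<in> edges P" for e
        using that f(2) len xs(3) by auto
      show "f x < f y" if "x \<in> vertices P" "y \<in> vertices P" "x < y" for x y
        using J(3)[OF that] fJ that by blast
    qed
    then show False using nc by contradiction
  qed
  then obtain n where n: "n < p" "card (S n) < m" and before: "\<And>i. i < n \<Longrightarrow> \<not> (i < p \<and> card (S i) < m)"
    using exists_least_iff[of "\<lambda>i. i < p \<and> card (S i) < m"] by blast
  \<comment> \<open>The first reachable set is a whole block, so the first drop has a
    predecessor.\<close>
  have "n \<noteq> 0"
  proof
    assume "n = 0"
    then have "card (S n) = 2 * m" using J(2)[OF mem[OF \<open>n < p\<close>]] by (simp add: S_0)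
    then show False using n(2) by simp
  qed
  then obtain k where k: "n = Suc k" using not0_implies_Suc by blast
  define A where "A = S k"
  \<comment> \<open>Any element of this block joined to \<open>A\<close> lies in \<open>S n\<close>,
    so removing \<open>S n\<close> leaves no edge to \<open>A\<close>.\<close>
  define B where "B = J (xs ! n) - S n"
  have memk: "xs ! k \<in> vertices P" and memn: "xs ! n \<in> vertices P" using mem n(1) k by auto
  have "xs ! k \<noteq> xs ! n" using k n(1) xs(1) len by (simp add: nth_eq_iff_index_eq)
  then have "J (xs ! k) \<inter> J (xs ! n) = {}"
    using J(3)[OF memk memn] J(3)[OF memn memk] by (metis disjoint_iff linorder_neqE order_less_irrefl)
  show ?thesis
  proof (rule that)
    show "A \<subseteq> V" using S_sub J(1)[OF memk] by (auto simp: A_def)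
    show "B \<subseteq> V" using J(1)[OF memn] by (auto simp: B_def)
    show "A \<inter> B = {}" using S_sub[of k] \<open>J (xs ! k) \<inter> J (xs ! n) = {}\<close> by (auto simp: A_def B_def)
    show "m \<le> card A" using before[of k] k n(1) by (simp add: A_def)
    have "card B = 2 * m - card (S n)"
      unfolding B_def using S_sub[of n] J(1,2)[OF memn] \<open>finite V\<close>
      by (metis card_Diff_subset finite_subset)
    then show "m \<le> card B" using n(2) by linarith
    show "{a, b} \<notin> E" if "a \<in> A" "b \<in> B" for a b
      using that by (auto simp: A_def B_def k S_Suc)
  qed
qed

text \<open>Each passage to a sparse pair costs a factor \<open>2 * p\<close>, and uniting the sets
  found on its two sides doubles their size. At \<open>p\<close> vertices one missing pair suffices,
  whence the exponent \<open>Suc k\<close>.\<close>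

lemma path_or_independent_set:
  fixes P :: "'a::linorder ograph" and V :: "'b::linorder set" and E :: "'b set set"
  assumes P: "ordered_path p P" and "p > 0"
    and "finite V" "p * (2 * p) ^ k \<le> card V" "\<not> contained_in P (V, E)"
  shows "\<exists>W\<subseteq>V. card W = 2 ^ Suc k \<and> nsets W 2 \<inter> E = {}"
  using assms(3-5)
proof (induction k arbitrary: V)
  case 0
  have "ordered_graph P" "card (vertices P) = p" "finite (vertices P)"
    using P \<open>p > 0\<close> by (auto simp: ordered_path_def card_gt_0_iff)
  then have "contained_in P (V, nsets V 2)"
    using 0 by (intro contained_in_complete) auto
  then have "\<not> nsets V 2 \<subseteq> E"
    using 0(3) contained_in_mono by blast
  then obtain e where e: "e \<subseteq> V" "finite e" "card e = 2" "e \<notin> E"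
    by (auto simp: nsets_def)
  have "nsets e 2 = {e}"
    using e by (auto simp: nsets_def dest: card_subset_eq)
  then show ?case using e by (intro exI[of _ e]) auto
next
  case (Suc k)
  \<comment> \<open>Regrouped as \<open>p * (2 * m)\<close>, with \<open>m\<close> the size that the
    induction hypothesis requires.\<close>
  have "p * (2 * (p * (2 * p) ^ k)) \<le> card V" using Suc.prems(2) by (simp add: algebra_simps)
  then obtain A B where AB: "A \<subseteq> V" "B \<subseteq> V" "A \<inter> B = {}"
    "p * (2 * p) ^ k \<le> card A" "p * (2 * p) ^ k \<le> card B"
    "\<And>a b. \<lbrakk>a \<in> A; b \<in> B\<rbrakk> \<Longrightarrow> {a, b} \<notin> E"
    using path_or_sparse_pair[OF P \<open>p > 0\<close> Suc.prems(1) _ Suc.prems(3)] by blast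
  have sub: "\<exists>W\<subseteq>X. card W = 2 ^ Suc k \<and> nsets W 2 \<inter> E = {}"
    if "X \<subseteq> V" "p * (2 * p) ^ k \<le> card X" for X
    using that Suc.prems(1,3) contained_in_mono[OF _ \<open>X \<subseteq> V\<close> order_refl, of P E]
    by (intro Suc.IH) (auto intro: finite_subset)
  obtain W1 W2 where W: "W1 \<subseteq> A" "card W1 = 2 ^ Suc k" "nsets W1 2 \<inter> E = {}"
    "W2 \<subseteq> B" "card W2 = 2 ^ Suc k" "nsets W2 2 \<inter> E = {}"
    using sub AB by meson
  have fin: "finite W1" "finite W2"
    using W AB Suc.prems(1) by (meson finite_subset)+
  have "card (W1 \<union> W2) = 2 ^ Suc (Suc k)"
    using W fin AB(3) by (subst card_Un_disjoint) auto
  moreover have "e \<notin> E" if e: "e \<in> nsets (W1 \<union> W2) 2" for e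
  proof -
    obtain x y where xy: "e = {x, y}" "x \<noteq> y" "x \<in> W1 \<union> W2" "y \<in> W1 \<union> W2"
      using e by (auto simp: nsets_def card_2_iff)
    then consider "e \<in> nsets W1 2" | "e \<in> nsets W2 2" | "x \<in> A" "y \<in> B" | "y \<in> A" "x \<in> B"
      using W by (auto simp: nsets_def)
    then show ?thesis
      by cases (use W(3,6) AB(6) xy(1) in \<open>metis disjoint_iff insert_commute\<close>)+
  qed
  ultimately show ?case
    using W AB by (intro exI[of _ "W1 \<union> W2"]) auto
qed

section \<open>The exponent and the induction over the colours\<close>

primrec ramsey_exponent :: "nat \<Rightarrow> nat \<Rightarrow> nat" where
  "ramsey_exponent l 0 = 1"
| "ramsey_exponent l (Suc t) = (l + 1) * ramsey_exponent l t - 1"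

lemma ramsey_exponent_pos: "l > 0 \<Longrightarrow> ramsey_exponent l t > 0"
proof (induction t)
  case (Suc t)
  have "2 * 1 \<le> (l + 1) * ramsey_exponent l t"
    using Suc by (intro mult_le_mono) auto
  then show ?case by simp
qed simp

text \<open>The recursion has fixed point \<open>1 / l\<close>, and the distance to it grows by the
  factor \<open>l + 1\<close>. Starting at \<open>Suc t\<close> matches the power
  \<open>t - 1\<close> in \<open>path_exponent\<close>.\<close>

lemma ramsey_exponent_closed_form:
  assumes "l > 0"
  shows "real l * real (ramsey_exponent l (Suc t)) = (real l + 1) ^ t * ((real l)\<^sup>2 - 1) + 1"
proof (induction t)
  case 0
  then show ?case by (simp add: power2_eq_square)
next
  case (Suc t)
  have "1 \<le> (l + 1) * ramsey_exponent l (Suc t)"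
    using ramsey_exponent_pos[OF assms, of "Suc t"] by simp
  then have step: "real (ramsey_exponent l (Suc (Suc t))) = (real l + 1) * real (ramsey_exponent l (Suc t)) - 1"
    unfolding ramsey_exponent.simps(2)[of l "Suc t"]
    by (simp add: of_nat_diff algebra_simps del: ramsey_exponent.simps)
  have "real l * real (ramsey_exponent l (Suc (Suc t))) =
      (real l + 1) * (real l * real (ramsey_exponent l (Suc t))) - real l"
    unfolding step by (simp only: right_diff_distrib mult_1_right mult.left_commute)
  then show ?case unfolding Suc by (simp add: algebra_simps)
qed

text \<open>Either the last colour contains the path, or some \<open>W\<close> avoids that colour
  and is large enough for the others. As \<open>W\<close> is an arbitrary subset, \<open>V\<close>
  is kept general.\<close>

lemma monochromatic_path:
  fixes P :: "'a::linorder ograph" and V :: "'b::linorder set"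
  assumes P: "ordered_path p P" and "p > 0" "p \<le> 2 ^ l" "l > 0"
    and "finite V" "2 ^ ramsey_exponent l t \<le> card V" "c \<in> nsets V 2 \<rightarrow> {1..t}"
  shows "\<exists>i\<in>{1..t}. contained_in P (V, {e \<in> nsets V 2. c e = i})"
  using assms(5-7)
proof (induction t arbitrary: V)
  case 0
  \<comment> \<open>Exponent 1 provides a pair, whose colour would lie in the empty set
    \<open>{1..0}\<close>.\<close>
  then have "card V \<ge> 2" by simp
  then obtain e where "e \<subseteq> V" "card e = 2" "finite e"
    by (rule obtain_subset_with_card_n)
  then have "c e \<in> {1..0}" using 0(3) by (auto simp: nsets_def Pi_iff)
  then show ?case by simp
next
  case (Suc t)
  show ?case
  proof (cases "contained_in P (V, {e \<in> nsets V 2. c e = Suc t})")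
    case True
    then show ?thesis by auto
  next
    case False
    obtain k where k: "ramsey_exponent l t = Suc k"
      using ramsey_exponent_pos[OF \<open>l > 0\<close>] gr0_implies_Suc by blast
    have "p * (2 * p) ^ k \<le> 2 ^ l * (2 * 2 ^ l) ^ k"
      using \<open>p \<le> 2 ^ l\<close> by (intro mult_le_mono power_mono) auto
    also have "\<dots> = 2 ^ (l + (l + 1) * k)"
      by (simp add: power_add power_mult power_mult_distrib)
    \<comment> \<open>Substituting \<open>k = ramsey_exponent l t - 1\<close> is what produces the
      \<open>- 1\<close> of the recursion.\<close>
    also have "l + (l + 1) * k = ramsey_exponent l (Suc t)"
      by (simp add: k)
    finally obtain W where W: "W \<subseteq> V" "card W = 2 ^ Suc k"
      "nsets W 2 \<inter> {e \<in> nsets V 2. c e = Suc t} = {}"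
      using path_or_independent_set[OF P \<open>p > 0\<close> Suc.prems(1) _ False] Suc.prems(2)
      by (meson order_trans)
    have sub: "nsets W 2 \<subseteq> nsets V 2" using W(1) by (rule nsets_mono)
    have "c e \<in> {1..t}" if "e \<in> nsets W 2" for e
    proof -
      have "c e \<in> {1..Suc t}" using that sub Suc.prems(3) by auto
      moreover have "c e \<noteq> Suc t" using that sub W(3) by auto
      ultimately show ?thesis by auto
    qed
    then have "c \<in> nsets W 2 \<rightarrow> {1..t}" by (rule Pi_I)
    moreover have "finite W" using W(1) Suc.prems(1) by (rule finite_subset)
    ultimately obtain i where i: "i \<in> {1..t}" "contained_in P (W, {e \<in> nsets W 2. c e = i})"
      using Suc.IH[of W] W(2) k by auto
    have "{e \<in> nsets W 2. c e = i} \<subseteq> {e \<in> nsets V 2. c e = i}" using sub by auto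
    then have "contained_in P (V, {e \<in> nsets V 2. c e = i})"
      by (rule contained_in_mono[OF i(2) W(1)])
    then show ?thesis using i(1) by (intro bexI[of _ i]) auto
  qed
qed

lemma ordered_ramsey_path_le:
  assumes P: "ordered_path p P" and "p > 0" "p \<le> 2 ^ l" "l > 0"
  shows "ordered_ramsey t P \<le> 2 ^ ramsey_exponent l t"
  unfolding ordered_ramsey_def color_class_def complete_graph_def fst_conv snd_conv
proof (intro Least_le ballI)
  fix c :: "nat set \<Rightarrow> nat"
  assume "c \<in> nsets {1..2 ^ ramsey_exponent l t} 2 \<rightarrow> {1..t}"
  then show "\<exists>i\<in>{1..t}. contained_in P ({1..2 ^ ramsey_exponent l t},
      {e \<in> nsets {1..2 ^ ramsey_exponent l t} 2. c e = i})"
    by (intro monochromatic_path[OF assms]) auto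
qed

section \<open>Logarithms and asymptotics\<close>

lemma ceiling_log2_bounds:
  assumes "p \<ge> 2"
  defines "l \<equiv> nat \<lceil>log 2 (real p)\<rceil>"
  shows "real_of_int \<lceil>log 2 (real p)\<rceil> = real l" "l > 0" "p \<le> 2 ^ l" "real l \<le> 2 * log 2 (real p)"
proof -
  have log: "log 2 (real p) \<ge> 1" using assms by simp
  then show l: "real_of_int \<lceil>log 2 (real p)\<rceil> = real l" and "l > 0"
    unfolding l_def by linarith+
  have "real p = 2 powr log 2 (real p)" using assms by simp
  also have "\<dots> \<le> 2 powr real l" unfolding l[symmetric] by (intro powr_mono) auto
  also have "\<dots> = real (2 ^ l)" by (simp add: powr_realpow)
  finally show "p \<le> 2 ^ l" by (simp only: of_nat_le_iff)
  show "real l \<le> 2 * log 2 (real p)" using log l by linarith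
qed

text \<open>The constant 4 combines \<open>l + 1 \<le> 2 * l\<close> with
  \<open>l \<le> 2 * log 2 p\<close>, once for each of the \<open>t\<close> factors.\<close>

lemma path_exponent_le:
  assumes "t \<ge> 1" "p \<ge> 2"
  shows "0 \<le> path_exponent t p" "path_exponent t p \<le> 4 ^ t * log 2 (real p) ^ t"
proof -
  define l where "l = nat \<lceil>log 2 (real p)\<rceil>"
  note l = ceiling_log2_bounds[OF \<open>p \<ge> 2\<close>, folded l_def]
  obtain s where t: "t = Suc s" using \<open>t \<ge> 1\<close> by (cases t) auto
  have eq: "path_exponent t p = ((real l + 1) ^ s * ((real l)\<^sup>2 - 1) + 1) / real l"
    by (simp add: path_exponent_def l(1) t Let_def)
  have l1: "real l \<ge> 1" using l(2) by simp
  then have pow: "(real l + 1) ^ s \<ge> 1" and sq: "(real l)\<^sup>2 \<ge> 1" by simp_all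
  show "0 \<le> path_exponent t p" unfolding eq using l1 pow sq by (intro divide_nonneg_pos) auto
  \<comment> \<open>The final \<open>+ 1\<close> is absorbed by the subtracted power, which is at
    least 1.\<close>
  have "(real l + 1) ^ s * ((real l)\<^sup>2 - 1) + 1 \<le> (real l + 1) ^ s * (real l)\<^sup>2"
    using pow by (simp add: algebra_simps)
  then have "path_exponent t p \<le> (real l + 1) ^ s * (real l)\<^sup>2 / real l"
    unfolding eq by (intro divide_right_mono) auto
  also have "\<dots> = (real l + 1) ^ s * real l" using l1 by (simp add: power2_eq_square)
  also have "\<dots> \<le> (2 * real l) ^ s * (2 * real l)"
    using l1 by (intro mult_mono power_mono) auto
  also have "\<dots> = (2 * real l) ^ t" by (simp add: t)
  also have "\<dots> \<le> (4 * log 2 (real p)) ^ t" using l1 l(4) by (intro power_mono) auto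
  also have "\<dots> = 4 ^ t * log 2 (real p) ^ t" by (rule power_mult_distrib)
  finally show "path_exponent t p \<le> 4 ^ t * log 2 (real p) ^ t" .
qed

text \<open>The asymptotic equality is expressed on the exponents, for fixed \<open>t\<close> and
  growing \<open>p\<close>.\<close>

theorem theorem7:
  fixes t :: nat
  assumes "t \<ge> 1"
  shows "(\<forall>p\<ge>2. \<forall>P :: 'a::linorder ograph. ordered_path p P \<longrightarrow>
            real (ordered_ramsey t P) \<le> 2 powr path_exponent t p) \<and>
         (\<lambda>p. path_exponent t p) \<in> O(\<lambda>p. log 2 (real p) ^ t)"
proof (intro conjI allI impI)
  fix p :: nat and P :: "'a ograph"
  assume p: "p \<ge> 2" and P: "ordered_path p P"
  define l where "l = nat \<lceil>log 2 (real p)\<rceil>"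
  note l = ceiling_log2_bounds[OF p, folded l_def]
  have "real l * real (ramsey_exponent l t) = (real l + 1) ^ (t - 1) * ((real l)\<^sup>2 - 1) + 1"
    using ramsey_exponent_closed_form[OF l(2), of "t - 1"] assms by simp
  \<comment> \<open>The real exponent is exactly a natural number, so nothing is lost by
    rounding.\<close>
  then have "path_exponent t p = real (ramsey_exponent l t)"
    using l(2) by (simp add: path_exponent_def l(1) Let_def field_simps)
  then have "2 powr path_exponent t p = real (2 ^ ramsey_exponent l t)"
    by (simp add: powr_realpow)
  then show "real (ordered_ramsey t P) \<le> 2 powr path_exponent t p"
    using ordered_ramsey_path_le[OF P _ l(3,2), of t] p by (simp only: of_nat_le_iff)
next
  have "norm (path_exponent t p) \<le> 4 ^ t * norm (log 2 (real p) ^ t)" if "p \<ge> 2" for p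
    using path_exponent_le[OF assms that] that by simp
  then show "(\<lambda>p. path_exponent t p) \<in> O(\<lambda>p. log 2 (real p) ^ t)"
    by (intro bigoI[where c = "4 ^ t"] eventually_sequentiallyI[of 2])
qed

end
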